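(* Let $1\le p\le\infty$ and let $L_{T,p}\colon\ell_p\to\ell_p$ be the forward Collatz-Koopman operator, which sends $x=(x_n)_{n\ge1}$ to the sequence whose $m$-th coordinate is $\sum_{n:\,T(n)=m}x_n$. Then $L_{T,p}$ is a (well-defined) bounded linear operator and $\|L_{T,p}\|=2^{1-\frac1p}$, where for $p=\infty$ this means $\|L_{T,\infty}\|=2$.
   Context: $\mathbb{N}^*=\{1,2,3,\dots\}$. The Collatz map $T\colon\mathbb{N}^*\to\mathbb{N}^*$ is $T(n)=n/2$ for $n$ even and $T(n)=(3n+1)/2$ for $n$ odd. $\ell_p$ is the usual Banach space of scalar sequences $(x_n)_{n\in\mathbb{N}^*}$ with its $p$-norm, and $(e_n)$ denotes the standard unit vectors. For $p<\infty$ the operator is equivalently given by $L_{T,p}\left(\sum_n x_ne_n\right)=\sum_n x_ne_{T(n)}$. Every $m$ has one or two preimages under $T$, so the coordinate sums are finite. *)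

theory Defs
  imports "HOL-Analysis.Analysis"
begin

definition collatz :: "nat \<Rightarrow> nat" where
  "collatz n = (if even n then n div 2 else (3 * n + 1) div 2)"

text \<open>
  A scalar sequence indexed by the positive integers is represented by a function on \<^typ>\<open>nat\<close>
  that vanishes at the unused index 0. The class constraint on the scalars covers
  \<^typ>\<open>real\<close> and \<^typ>\<open>complex\<close>.
\<close>

definition ell :: "ennreal \<Rightarrow> (nat \<Rightarrow> 'k::{real_normed_field,banach}) set" where
  "ell p = {x. x 0 = 0 \<and>
     (if p = \<infinity> then bdd_above ((\<lambda>n. norm (x n)) ` {1..})
      else (\<lambda>n. norm (x n) powr enn2real p) summable_on {1..})}"

definition ell_norm :: "ennreal \<Rightarrow> (nat \<Rightarrow> 'k::{real_normed_field,banach}) \<Rightarrow> real" where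
  "ell_norm p x =
     (if p = \<infinity> then (SUP n\<in>{1..}. norm (x n))
      else (\<Sum>\<^sub>\<infinity>n\<in>{1..}. norm (x n) powr enn2real p) powr (1 / enn2real p))"

text \<open>
  The next two definitions are the library's \<^const>\<open>bounded_linear\<close> and \<^const>\<open>onorm\<close>
  relativised to the carrier \<open>ell p\<close>; a relativised version is needed because the exponent is a
  variable. Linearity is over the scalar field. As in \<^const>\<open>onorm\<close>, the zero sequence
  contributes the quotient \<open>0 / 0 = 0\<close>; the supremum is meaningful for bounded operators.
\<close>

definition ell_bounded_linear ::
    "ennreal \<Rightarrow> ((nat \<Rightarrow> 'k::{real_normed_field,banach}) \<Rightarrow> nat \<Rightarrow> 'k) \<Rightarrow> bool" where
  "ell_bounded_linear p A \<longleftrightarrow>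
     (\<forall>x\<in>ell p. A x \<in> ell p) \<and>
     (\<forall>x\<in>ell p. \<forall>y\<in>ell p. A (\<lambda>n. x n + y n) = (\<lambda>m. A x m + A y m)) \<and>
     (\<forall>c. \<forall>x\<in>ell p. A (\<lambda>n. c * x n) = (\<lambda>m. c * A x m)) \<and>
     (\<exists>K. \<forall>x\<in>ell p. ell_norm p (A x) \<le> ell_norm p x * K)"

definition ell_onorm ::
    "ennreal \<Rightarrow> ((nat \<Rightarrow> 'k::{real_normed_field,banach}) \<Rightarrow> nat \<Rightarrow> 'k) \<Rightarrow> real" where
  "ell_onorm p A = (SUP x\<in>ell p. ell_norm p (A x) / ell_norm p x)"

definition collatz_koopman ::
    "(nat \<Rightarrow> 'k::{real_normed_field,banach}) \<Rightarrow> nat \<Rightarrow> 'k" where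
  "collatz_koopman x = (\<lambda>m. \<Sum>n | 1 \<le> n \<and> collatz n = m. x n)"

end

theory Submission imports Defs begin

text \<open>
  Every \<open>m \<ge> 1\<close> has at most two preimages under the Collatz map: the even number \<open>2 * m\<close> and, when it
  is an odd integer, \<open>(2 * m - 1) / 3\<close>. The \<open>m\<close>-th coordinate of the image of \<open>x\<close> is
  therefore a sum of at most two coordinates of \<open>x\<close>, and each coordinate of \<open>x\<close> is used exactly
  once. For \<open>p = \<infinity>\<close> the triangle inequality gives the factor 2. For \<open>p < \<infinity>\<close> the power mean
  inequality \<open>(a + b) powr p \<le> 2 powr (p - 1) * (a powr p + b powr p)\<close> in each coordinate,
  summed over the disjoint fibres, bounds the \<open>p\<close>-th power of the norm by the factor
  \<open>2 powr (p - 1)\<close>, and the \<open>p\<close>-th root of this factor is \<open>2 powr (1 - 1 / p)\<close>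
  (\<open>ell_norm_collatz_koopman_le\<close>).

  Equality in the power mean inequality needs two equal coordinates in one fibre. Since
  \<open>1 \<mapsto> 2\<close> and \<open>4 \<mapsto> 2\<close>, the vector \<open>e\<^sub>1 + e\<^sub>4\<close>, of norm \<open>2 powr (1 / p)\<close>, is sent to
  \<open>2 e\<^sub>2\<close>, of norm 2, so the bound is attained. The exponent \<open>1 / p\<close> is read as 0
  for \<open>p = \<infinity>\<close>.
\<close>

section \<open>The fibres of the Collatz map\<close>

definition collatz_fibre :: "nat \<Rightarrow> nat set" where
  "collatz_fibre m = {n. 1 \<le> n \<and> collatz n = m}"

lemma mem_collatz_fibre [simp]: "n \<in> collatz_fibre m \<longleftrightarrow> 1 \<le> n \<and> collatz n = m"
  by (simp add: collatz_fibre_def)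

lemma collatz_koopman_altdef: "collatz_koopman x m = (\<Sum>n\<in>collatz_fibre m. x n)"
  by (simp add: collatz_koopman_def collatz_fibre_def)

lemma collatz_fibre_subset: "collatz_fibre m \<subseteq> {2 * m, (2 * m - 1) div 3}"
proof
  fix n assume "n \<in> collatz_fibre m"
  then have m: "m = collatz n" by simp
  show "n \<in> {2 * m, (2 * m - 1) div 3}"
  proof (cases "even n")
    case True
    then show ?thesis by (simp add: m collatz_def)
  next
    case False
    then have "2 * m = 3 * n + 1" by (simp add: m collatz_def)
    then show ?thesis by simp
  qed
qed

lemma finite_collatz_fibre [simp]: "finite (collatz_fibre m)"
  using collatz_fibre_subset by (rule finite_subset) simp

lemma card_collatz_fibre_le: "card (collatz_fibre m) \<le> 2"
proof -
  have "card (collatz_fibre m) \<le> card {2 * m, (2 * m - 1) div 3}"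
    using collatz_fibre_subset by (rule card_mono[rotated]) simp
  also have "\<dots> \<le> 2" by (simp add: card_insert_if)
  finally show ?thesis .
qed

lemma collatz_fibre_0: "collatz_fibre 0 = {}"
  using collatz_fibre_subset[of 0] by auto

lemma collatz_fibre_2: "collatz_fibre 2 = {1, 4}"
proof
  show "collatz_fibre 2 \<subseteq> {1, 4}" using collatz_fibre_subset[of 2] by auto
  show "{1, 4} \<subseteq> collatz_fibre 2" by (simp add: collatz_def)
qed

section \<open>The power mean inequality\<close>

text \<open>
  Jensen's inequality for the convex function \<open>x powr p\<close> on the positive half-line. Zero entries
  are dropped first; this does not change either sum and only decreases the number of entries.
\<close>
lemma powr_sum_le_powr_times_sum_powr:
  fixes a :: "'a \<Rightarrow> real" and p :: real
  assumes p: "1 \<le> p" and S: "finite S" "card S \<le> d" and a: "\<And>i. i \<in> S \<Longrightarrow> 0 \<le> a i"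
  shows "(\<Sum>i\<in>S. a i) powr p \<le> real d powr (p - 1) * (\<Sum>i\<in>S. a i powr p)"
proof -
  define R where "R = {i \<in> S. 0 < a i}"
  have R: "finite R" "R \<subseteq> S" using S by (auto simp: R_def)
  have zero: "a i = 0" if "i \<in> S - R" for i
    using that a[of i] by (auto simp: R_def)
  have sums: "(\<Sum>i\<in>S. a i) = (\<Sum>i\<in>R. a i)" "(\<Sum>i\<in>S. a i powr p) = (\<Sum>i\<in>R. a i powr p)"
    by (rule sum.mono_neutral_right; use S R zero in simp)+
  show ?thesis
  proof (cases "R = {}")
    case True
    then show ?thesis by (simp add: sums)
  next
    case False
    define k where "k = real (card R)"
    have k: "0 < k" "k \<le> real d"
      using False R S card_mono[OF S(1) R(2)] by (auto simp: k_def card_gt_0_iff)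
    have "(\<Sum>i\<in>R. (1 / k) *\<^sub>R a i) powr p \<le> (\<Sum>i\<in>R. (1 / k) * a i powr p)"
      using convex_on_sum[OF R(1) False powr_convex[OF p], of "\<lambda>_. 1 / k" a] k
      by (simp add: R_def k_def)
    then have "((\<Sum>i\<in>R. a i) / k) powr p \<le> (\<Sum>i\<in>R. a i powr p) / k"
      by (simp add: sum_divide_distrib)
    moreover have "0 \<le> (\<Sum>i\<in>R. a i)" by (rule sum_nonneg) (auto simp: R_def)
    ultimately have "(\<Sum>i\<in>R. a i) powr p \<le> k powr (p - 1) * (\<Sum>i\<in>R. a i powr p)"
      using k by (simp add: powr_divide powr_diff field_simps)
    also have "\<dots> \<le> real d powr (p - 1) * (\<Sum>i\<in>R. a i powr p)"
      using k p by (intro mult_right_mono powr_mono2 sum_nonneg) auto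
    finally show ?thesis by (simp add: sums)
  qed
qed

section \<open>Norms of sequences\<close>

lemma enn2real_ge_1:
  assumes "1 \<le> p" "p \<noteq> \<infinity>"
  shows "1 \<le> enn2real p"
proof -
  have "enn2real 1 \<le> enn2real p" using assms by (intro enn2real_mono) (auto simp: less_top)
  then show ?thesis by simp
qed

lemma ell_top_norm_le:
  assumes "x \<in> ell \<infinity>"
  shows "norm (x n) \<le> ell_norm \<infinity> x"
proof (cases "n = 0")
  case True
  have "0 \<le> norm (x 1)" by simp
  also have "\<dots> \<le> ell_norm \<infinity> x"
    unfolding ell_norm_def using assms by (auto simp: ell_def intro!: cSUP_upper)
  finally show ?thesis using assms True by (simp add: ell_def)
next
  case False
  then show ?thesis
    unfolding ell_norm_def using assms by (auto simp: ell_def intro!: cSUP_upper)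
qed

lemma ell_norm_nonneg:
  assumes "x \<in> ell p"
  shows "0 \<le> ell_norm p x"
proof (cases "p = \<infinity>")
  case True
  then show ?thesis using order_trans[OF norm_ge_zero ell_top_norm_le[of x 0]] assms by simp
qed (simp add: ell_norm_def)

lemma constant_on_finite_in_ell:
  fixes c :: "'k::{real_normed_field,banach}"
  assumes S: "finite S" "0 \<notin> S"
  shows "(\<lambda>n. if n \<in> S then c else 0) \<in> ell p"
proof -
  let ?x = "\<lambda>n. if n \<in> S then c else 0"
  have "bdd_above ((\<lambda>n. norm (?x n)) ` {1..})"
    by (rule bdd_aboveI[of _ "norm c"]) auto
  moreover have "(\<lambda>n. norm (?x n) powr enn2real p) summable_on {1..}"
    by (subst summable_on_cong_neutral[where T = S and g = "\<lambda>_. norm c powr enn2real p"])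
       (use S in \<open>auto simp: not_less_eq_eq\<close>)
  ultimately show ?thesis using S by (simp add: ell_def)
qed

lemma ell_norm_constant_on_finite:
  fixes c :: "'k::{real_normed_field,banach}"
  assumes p: "1 \<le> p" and S: "finite S" "0 \<notin> S" "S \<noteq> {}"
  shows "ell_norm p (\<lambda>n. if n \<in> S then c else 0) =
    (if p = \<infinity> then norm c else real (card S) powr (1 / enn2real p) * norm c)"
proof (cases "p = \<infinity>")
  case True
  obtain s where s: "s \<in> S" using S by auto
  then have "s \<ge> 1" using S by (cases s) auto
  then have "(SUP n\<in>{1..}. norm (if n \<in> S then c else 0)) = norm c"
    using s by (intro cSup_eq_maximum) force+
  then show ?thesis by (simp add: ell_norm_def True)
next
  case False
  have q: "1 \<le> enn2real p" using enn2real_ge_1 p False .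
  have "(\<Sum>\<^sub>\<infinity>n\<in>{1..}. norm (if n \<in> S then c else 0) powr enn2real p)
      = (\<Sum>\<^sub>\<infinity>n\<in>S. norm c powr enn2real p)"
    using S by (intro infsum_cong_neutral) (auto simp: not_less_eq_eq)
  also have "\<dots> = real (card S) * norm c powr enn2real p"
    using S by simp
  finally show ?thesis
    using q False by (simp add: ell_norm_def powr_mult powr_powr)
qed

section \<open>The upper bound\<close>

text \<open>
  Over a finite set \<open>F\<close> of target coordinates the fibres are finite and pairwise disjoint, so the
  double sum over \<open>m \<in> F\<close> and over the fibre of \<open>m\<close> is one finite partial sum of
  \<open>\<Sum>n. norm (x n) powr q\<close>. Both summability of the image and the norm bound follow from this.
\<close>
lemma sum_collatz_koopman_powr_le:
  fixes x :: "nat \<Rightarrow> 'k::{real_normed_field,banach}"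
  assumes q: "1 \<le> q" and x: "(\<lambda>n. norm (x n) powr q) summable_on {1..}" and F: "finite F"
  shows "(\<Sum>m\<in>F. norm (collatz_koopman x m) powr q)
    \<le> 2 powr (q - 1) * (\<Sum>\<^sub>\<infinity>n\<in>{1..}. norm (x n) powr q)"
proof -
  have coord: "norm (collatz_koopman x m) powr q
      \<le> 2 powr (q - 1) * (\<Sum>n\<in>collatz_fibre m. norm (x n) powr q)" for m
  proof -
    have "norm (collatz_koopman x m) powr q \<le> (\<Sum>n\<in>collatz_fibre m. norm (x n)) powr q"
      using q by (intro powr_mono2) (auto simp: collatz_koopman_altdef norm_sum)
    also have "\<dots> \<le> real 2 powr (q - 1) * (\<Sum>n\<in>collatz_fibre m. norm (x n) powr q)"
      using q card_collatz_fibre_le by (intro powr_sum_le_powr_times_sum_powr) auto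
    finally show ?thesis by simp
  qed
  have "(\<Sum>m\<in>F. norm (collatz_koopman x m) powr q)
      \<le> 2 powr (q - 1) * (\<Sum>m\<in>F. \<Sum>n\<in>collatz_fibre m. norm (x n) powr q)"
    unfolding sum_distrib_left[of _ _ F] by (intro sum_mono coord)
  also have "(\<Sum>m\<in>F. \<Sum>n\<in>collatz_fibre m. norm (x n) powr q)
      = (\<Sum>n\<in>(\<Union>m\<in>F. collatz_fibre m). norm (x n) powr q)"
    using F by (intro sum.UNION_disjoint[symmetric]) auto
  also have "\<dots> \<le> (\<Sum>\<^sub>\<infinity>n\<in>{1..}. norm (x n) powr q)"
    using x F by (intro finite_sum_le_infsum) auto
  finally show ?thesis by simp
qed

lemma norm_collatz_koopman_le_top:
  fixes x :: "nat \<Rightarrow> 'k::{real_normed_field,banach}"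
  assumes "x \<in> ell \<infinity>"
  shows "norm (collatz_koopman x m) \<le> 2 * ell_norm \<infinity> x"
proof -
  have "norm (collatz_koopman x m) \<le> (\<Sum>n\<in>collatz_fibre m. norm (x n))"
    by (simp add: collatz_koopman_altdef norm_sum)
  also have "\<dots> \<le> real (card (collatz_fibre m)) * ell_norm \<infinity> x"
    using assms by (intro sum_bounded_above ell_top_norm_le)
  also have "\<dots> \<le> 2 * ell_norm \<infinity> x"
    using card_collatz_fibre_le[of m] ell_norm_nonneg[OF assms] by (intro mult_right_mono) auto
  finally show ?thesis .
qed

lemma collatz_koopman_in_ell:
  fixes x :: "nat \<Rightarrow> 'k::{real_normed_field,banach}"
  assumes p: "1 \<le> p" and x: "x \<in> ell p"
  shows "collatz_koopman x \<in> ell p"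
proof -
  have 0: "collatz_koopman x 0 = 0" by (simp add: collatz_koopman_altdef collatz_fibre_0)
  show ?thesis
  proof (cases "p = \<infinity>")
    case True
    have "bdd_above ((\<lambda>n. norm (collatz_koopman x n)) ` {1..})"
      by (rule bdd_aboveI2) (use x True in \<open>auto intro: norm_collatz_koopman_le_top\<close>)
    then show ?thesis using True 0 by (simp add: ell_def)
  next
    case False
    have "(\<lambda>n. norm (collatz_koopman x n) powr enn2real p) summable_on {1..}"
    proof (rule nonneg_bdd_above_summable_on)
      show "bdd_above (sum (\<lambda>n. norm (collatz_koopman x n) powr enn2real p) `
          {F. F \<subseteq> {1..} \<and> finite F})"
        by (rule bdd_aboveI2, rule sum_collatz_koopman_powr_le)
           (use x False enn2real_ge_1[OF p] in \<open>auto simp: ell_def\<close>)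
    qed simp
    then show ?thesis using False 0 by (simp add: ell_def)
  qed
qed

lemma ell_norm_collatz_koopman_le:
  fixes x :: "nat \<Rightarrow> 'k::{real_normed_field,banach}"
  assumes p: "1 \<le> p" and x: "x \<in> ell p"
  shows "ell_norm p (collatz_koopman x)
    \<le> ell_norm p x * (if p = \<infinity> then 2 else 2 powr (1 - 1 / enn2real p))"
proof (cases "p = \<infinity>")
  case True
  have "(SUP m\<in>{1..}. norm (collatz_koopman x m)) \<le> 2 * ell_norm \<infinity> x"
    using x True by (intro cSUP_least norm_collatz_koopman_le_top) auto
  then show ?thesis by (simp add: True ell_norm_def mult.commute)
next
  case False
  define q where "q = enn2real p"
  have q: "1 \<le> q" unfolding q_def using enn2real_ge_1 p False .
  have summable: "(\<lambda>n. norm (y n) powr q) summable_on {1..}" if "y \<in> ell p"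
    for y :: "nat \<Rightarrow> 'k"
    using that False by (simp add: ell_def q_def)
  have "(\<Sum>\<^sub>\<infinity>m\<in>{1..}. norm (collatz_koopman x m) powr q)
      \<le> 2 powr (q - 1) * (\<Sum>\<^sub>\<infinity>n\<in>{1..}. norm (x n) powr q)"
    by (intro infsum_le_finite_sums summable collatz_koopman_in_ell p x
        sum_collatz_koopman_powr_le q)
  then have "(\<Sum>\<^sub>\<infinity>m\<in>{1..}. norm (collatz_koopman x m) powr q) powr (1 / q)
      \<le> (2 powr (q - 1) * (\<Sum>\<^sub>\<infinity>n\<in>{1..}. norm (x n) powr q)) powr (1 / q)"
    using q by (intro powr_mono2) (auto intro: infsum_nonneg)
  also have "\<dots> = 2 powr ((q - 1) / q) * (\<Sum>\<^sub>\<infinity>n\<in>{1..}. norm (x n) powr q) powr (1 / q)"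
    by (simp add: powr_mult powr_powr infsum_nonneg)
  also have "(q - 1) / q = 1 - 1 / q"
    using q by (simp add: field_simps)
  finally show ?thesis
    using False by (simp add: ell_norm_def q_def mult.commute)
qed

section \<open>Sharpness\<close>

lemma collatz_koopman_e1_plus_e4:
  "collatz_koopman (\<lambda>n. if n \<in> {1, 4} then 1 else 0)
    = (\<lambda>m. if m \<in> {2} then 2 else (0 :: 'k::{real_normed_field,banach}))"
proof
  fix m :: nat
  show "collatz_koopman (\<lambda>n. if n \<in> {1, 4} then 1 else 0) m = (if m \<in> {2} then 2 else (0 :: 'k))"
  proof (cases "m = 2")
    case True
    then show ?thesis unfolding collatz_koopman_altdef True collatz_fibre_2 by simp
  next
    case False
    then have "n \<notin> {1, 4}" if "n \<in> collatz_fibre m" for n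
      using that by (auto simp: collatz_def)
    then show ?thesis using False by (simp add: collatz_koopman_altdef)
  qed
qed

theorem theorem4p2:
  fixes p :: ennreal
  assumes "1 \<le> p"
  shows "(\<forall>m\<ge>1. finite {n. 1 \<le> n \<and> collatz n = m}) \<and>
    ell_bounded_linear p
      (collatz_koopman :: (nat \<Rightarrow> 'k::{real_normed_field,banach}) \<Rightarrow> nat \<Rightarrow> 'k) \<and>
    ell_onorm p
      (collatz_koopman :: (nat \<Rightarrow> 'k::{real_normed_field,banach}) \<Rightarrow> nat \<Rightarrow> 'k)
      = (if p = \<infinity> then 2 else 2 powr (1 - 1 / enn2real p))"
proof (intro conjI)
  let ?L = "collatz_koopman :: (nat \<Rightarrow> 'k) \<Rightarrow> nat \<Rightarrow> 'k"
  define K where "K = (if p = \<infinity> then 2 else 2 powr (1 - 1 / enn2real p))"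
  have le: "ell_norm p (?L x) \<le> ell_norm p x * K" if "x \<in> ell p" for x
    unfolding K_def using assms that by (rule ell_norm_collatz_koopman_le)
  have "0 \<le> K" by (simp add: K_def)
  show "\<forall>m\<ge>1. finite {n. 1 \<le> n \<and> collatz n = m}"
    using finite_collatz_fibre by (simp add: collatz_fibre_def)
  show "ell_bounded_linear p ?L"
    unfolding ell_bounded_linear_def
    using le collatz_koopman_in_ell[OF assms]
    by (auto simp: collatz_koopman_altdef fun_eq_iff sum.distrib sum_distrib_left)
  define w :: "nat \<Rightarrow> 'k" where "w = (\<lambda>n. if n \<in> {1, 4} then 1 else 0)"
  have w: "w \<in> ell p"
    unfolding w_def by (rule constant_on_finite_in_ell) auto
  have norm_w: "ell_norm p w = (if p = \<infinity> then 1 else 2 powr (1 / enn2real p))"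
    unfolding w_def by (subst ell_norm_constant_on_finite) (use assms in auto)
  have norm_Lw: "ell_norm p (?L w) = 2"
    unfolding w_def collatz_koopman_e1_plus_e4
    by (subst ell_norm_constant_on_finite) (use assms in auto)
  have "ell_norm p (?L w) / ell_norm p w = K"
    by (simp add: norm_w norm_Lw K_def powr_diff)
  then have "K \<in> (\<lambda>x. ell_norm p (?L x) / ell_norm p x) ` ell p"
    using w by force
  moreover have "ell_norm p (?L x) / ell_norm p x \<le> K" if "x \<in> ell p" for x
    using le[OF that] ell_norm_nonneg[OF that] \<open>0 \<le> K\<close>
    by (cases "ell_norm p x = 0") (auto simp: field_simps)
  ultimately have "ell_onorm p ?L = K"
    unfolding ell_onorm_def by (intro cSup_eq_maximum) auto
  then show "ell_onorm p ?L = (if p = \<infinity> then 2 else 2 powr (1 - 1 / enn2real p))"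
    by (simp add: K_def)
qed

end
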